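(* Suppose that the limits $$\lim_{\mathcal U_h\to\mathcal U}\mathrm{Tr}_{\boldsymbol M_{\boldsymbol u}}(\boldsymbol W_{\boldsymbol u}^{-1})\qquad\text{and}\qquad \lim_{\mathcal Z_h\to\mathcal Z}\mathrm{Tr}_{\boldsymbol M_{\boldsymbol z}}(\boldsymbol W_{\boldsymbol z}^{-1})$$ exist and are finite, where $\mathcal U_h\to\mathcal U$, $\mathcal Z_h\to\mathcal Z$ denotes refinement of the discretization, and suppose that $$\lim_{\mathcal U_h\to\mathcal U,\ \mathcal Z_h\to\mathcal Z}\tilde{\boldsymbol z}=\tilde z\in\mathcal Z,$$ that is, the elements of $\mathcal Z_h\subset\mathcal Z$ with coordinate vectors $\tilde{\boldsymbol z}$ converge in $\mathcal Z$ to some $\tilde z\in\mathcal Z$. Then $$\lim_{\mathcal U_h\to\mathcal U,\ \mathcal Z_h\to\mathcal Z}\mathrm{Tr}_{\boldsymbol M_{\boldsymbol\theta}}(\boldsymbol W_{\boldsymbol\theta}^{-1})$$ exists and is finite.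
   Context: $\mathcal U$ and $\mathcal Z$ are (real) Hilbert spaces. They are discretized by a refining family of finite-dimensional subspaces $\mathcal U_h\subset\mathcal U$ with basis $\{\eta_i\}_{i=1}^{n_u}$ and $\mathcal Z_h\subset\mathcal Z$ with basis $\{\varphi_j\}_{j=1}^{n_z}$ (if $\mathcal Z$ is finite-dimensional, $\mathcal Z_h=\mathcal Z$). Gram matrices: $(\boldsymbol M_{\boldsymbol u})_{i,j}=(\eta_i,\eta_j)_{\mathcal U}$, $(\boldsymbol M_{\boldsymbol z})_{i,j}=(\varphi_i,\varphi_j)_{\mathcal Z}$. All bold quantities depend on the discretization. $\tilde{\boldsymbol z}\in\mathbb R^{n_z}$ is the coordinate vector of the solution (a local minimizer) of the discretized low-fidelity optimization problem $\min_{\boldsymbol z\in\mathbb R^{n_z}}J(\tilde S(\boldsymbol z),\boldsymbol z)$, where $J:\mathbb R^{n_u}\times\mathbb R^{n_z}\to\mathbb R$ is the discretized objective and $\tilde S:\mathbb R^{n_z}\to\mathbb R^{n_u}$ the discretized low-fidelity solution operator. Covariance matrices: $\boldsymbol W_{\boldsymbol u}^{-1}=\alpha_{\boldsymbol u}\boldsymbol E_{\boldsymbol u}^{-1}\boldsymbol M_{\boldsymbol u}\boldsymbol E_{\boldsymbol u}^{-1}$ and $\boldsymbol W_{\boldsymbol z}^{-1}=\alpha_{\boldsymbol z}\boldsymbol E_{\boldsymbol z}^{-1}\boldsymbol M_{\boldsymbol z}\boldsymbol E_{\boldsymbol z}^{-1}$, with fixed $\alpha_{\boldsymbol u},\alpha_{\boldsymbol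 z}>0$, where $\boldsymbol E_{\boldsymbol u}\in\mathbb R^{n_u\times n_u}$, $\boldsymbol E_{\boldsymbol z}\in\mathbb R^{n_z\times n_z}$ are symmetric positive definite discretizations of Laplacian-like differential operators (e.g. $\boldsymbol E=\beta\boldsymbol K+\boldsymbol M$ with $\beta>0$ and $\boldsymbol K$ the stiffness matrix, discretizing $-\beta\Delta+I$; when $\mathcal Z$ is finite-dimensional one may take $\boldsymbol E_{\boldsymbol z}=\boldsymbol M_{\boldsymbol z}$). Standing assumption: in the refinement limit, $\boldsymbol W_{\boldsymbol u}^{-1}$ and $\boldsymbol W_{\boldsymbol z}^{-1}$ converge to covariance operators on $\mathcal U$ and $\mathcal Z$. This is to be understood as follows: the operators on $\mathcal U_h$, $\mathcal Z_h$ with coordinate matrices $\boldsymbol W_{\boldsymbol u}^{-1}\boldsymbol M_{\boldsymbol u}$, $\boldsymbol W_{\boldsymbol z}^{-1}\boldsymbol M_{\boldsymbol z}$, precomposed with the orthogonal projections onto $\mathcal U_h$, $\mathcal Z_h$, converge strongly (pointwise) to bounded operators on $\mathcal U$ and $\mathcal Z$. In the case of $\mathcal Z$ the limit is $\alpha_{\boldsymbol z}\mathcal E_z^{-2}$, where $\mathcal E_z$ is the self-adjoint operator discretized by $\boldsymbol E_{\boldsymbol z}$. Parameter space: $n_\theta=n_u(n_z+1)$, with inner product matrix and prior covariance matrix $$\boldsymbol M_{\boldsymbol\theta}=\begin{pmatrix}\boldsymbol M_{\boldsymbol u}&\boldsymbol 0\\ \boldsymbol 0&\boldsymbol M_{\boldsymbol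 u}\otimes\boldsymbol M_{\boldsymbol z}\end{pmatrix},$$ $$\boldsymbol W_{\boldsymbol\theta}^{-1}=\begin{pmatrix}(1+\tilde{\boldsymbol z}^T\boldsymbol M_{\boldsymbol z}\boldsymbol W_{\boldsymbol z}^{-1}\boldsymbol M_{\boldsymbol z}\tilde{\boldsymbol z})\boldsymbol W_{\boldsymbol u}^{-1}&-\boldsymbol W_{\boldsymbol u}^{-1}\otimes\tilde{\boldsymbol z}^T\boldsymbol M_{\boldsymbol z}\boldsymbol W_{\boldsymbol z}^{-1}\\ -\boldsymbol W_{\boldsymbol u}^{-1}\otimes\boldsymbol W_{\boldsymbol z}^{-1}\boldsymbol M_{\boldsymbol z}\tilde{\boldsymbol z}&\boldsymbol W_{\boldsymbol u}^{-1}\otimes\boldsymbol W_{\boldsymbol z}^{-1}\end{pmatrix}\in\mathbb R^{n_\theta\times n_\theta},$$ where $\otimes$ is the Kronecker product. Weighted trace of a covariance matrix: for a symmetric positive definite $\boldsymbol M$ and a covariance matrix $\boldsymbol C$ of coordinate vectors, $\mathrm{Tr}_{\boldsymbol M}(\boldsymbol C)$ is the trace in the $\boldsymbol M$ inner product of the associated covariance operator, i.e. the ordinary matrix trace of $\boldsymbol M^{1/2}\boldsymbol C\boldsymbol M^{1/2}$ (equivalently of $\boldsymbol M\boldsymbol C$). *)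

theory Defs
  imports
    "HOL-Analysis.Elementary_Topology"
    "HOL-Analysis.Inner_Product"
    "Jordan_Normal_Form.Gauss_Jordan_Elimination"
begin

section \<open>Real matrices\<close>

definition mat_trace :: "real mat \<Rightarrow> real" where
  "mat_trace A = (\<Sum>i<dim_row A. A $$ (i, i))"

definition sym_pos_def :: "real mat \<Rightarrow> bool" where
  "sym_pos_def A \<longleftrightarrow>
     dim_row A = dim_col A \<and> transpose_mat A = A \<and>
     (\<forall>x \<in> carrier_vec (dim_col A). x \<noteq> 0\<^sub>v (dim_col A) \<longrightarrow> scalar_prod x (A *\<^sub>v x) > 0)"

text \<open>Meaningful for symmetric positive definite arguments, which have exactly one symmetric
  positive definite square root.\<close>

definition mat_sqrt :: "real mat \<Rightarrow> real mat" where
  "mat_sqrt M = (THE S. sym_pos_def S \<and> S * S = M)"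

text \<open>Only used for invertible matrices.\<close>

abbreviation mat_inv :: "real mat \<Rightarrow> real mat" where
  "mat_inv A \<equiv> the (mat_inverse A)"

definition kron :: "real mat \<Rightarrow> real mat \<Rightarrow> real mat" where
  "kron A B = mat (dim_row A * dim_row B) (dim_col A * dim_col B)
     (\<lambda>(i, j). A $$ (i div dim_row B, j div dim_col B) * B $$ (i mod dim_row B, j mod dim_col B))"

text \<open>The trace, in the \<open>M\<close> inner product, of the covariance operator belonging to a covariance
  matrix \<open>C\<close> of coordinate vectors.\<close>

definition weighted_trace :: "real mat \<Rightarrow> real mat \<Rightarrow> real" where
  "weighted_trace M C = mat_trace (mat_sqrt M * C * mat_sqrt M)"

definition local_minimizer :: "nat \<Rightarrow> (real vec \<Rightarrow> real) \<Rightarrow> real vec \<Rightarrow> bool" where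
  "local_minimizer n f z \<longleftrightarrow>
     z \<in> carrier_vec n \<and>
     (\<exists>\<epsilon>>0. \<forall>x \<in> carrier_vec n. sqrt (scalar_prod (x - z) (x - z)) < \<epsilon> \<longrightarrow> f z \<le> f x)"

section \<open>Discretizations of a Hilbert space\<close>

text \<open>A discretization is indexed by a type \<open>'i\<close>, and the filter \<open>F\<close> on \<open>'i\<close> describes the refinement
  limit, e.g. \<^term>\<open>sequentially\<close> for a nested sequence of subspaces. Every fixed subspace is
  eventually contained in the finer ones, and together the subspaces exhaust the Hilbert space.\<close>

definition refining_family :: "'i filter \<Rightarrow> ('i \<Rightarrow> 'a::real_inner set) \<Rightarrow> bool" where
  "refining_family F V \<longleftrightarrow>
     F \<noteq> bot \<and>
     (\<forall>i. subspace (V i) \<and> (\<exists>B. finite B \<and> span B = V i)) \<and>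
     (\<forall>i. \<forall>\<^sub>F j in F. V i \<subseteq> V j) \<and>
     closure (\<Union>i. V i) = UNIV"

definition is_basis :: "'a::real_vector list \<Rightarrow> 'a set \<Rightarrow> bool" where
  "is_basis bs V \<longleftrightarrow> distinct bs \<and> independent (set bs) \<and> span (set bs) = V"

definition gram :: "'a::real_inner list \<Rightarrow> real mat" where
  "gram bs = mat (length bs) (length bs) (\<lambda>(i, j). inner (bs ! i) (bs ! j))"

definition from_coords :: "'a::real_vector list \<Rightarrow> real vec \<Rightarrow> 'a" where
  "from_coords bs x = (\<Sum>i<length bs. vec_index x i *\<^sub>R bs ! i)"

definition coords :: "'a::real_vector list \<Rightarrow> 'a \<Rightarrow> real vec" where
  "coords bs v = vec (length bs) (\<lambda>i. representation (set bs) v (bs ! i))"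

definition orth_proj :: "'a::real_inner set \<Rightarrow> 'a \<Rightarrow> 'a" where
  "orth_proj V x = (THE y. y \<in> V \<and> (\<forall>w\<in>V. inner (x - y) w = 0))"

text \<open>The operator on the span of \<open>bs\<close> with coordinate matrix \<open>A\<close>, precomposed with the orthogonal
  projection onto that span.\<close>

definition coord_op :: "'a::real_inner list \<Rightarrow> real mat \<Rightarrow> 'a \<Rightarrow> 'a" where
  "coord_op bs A v = from_coords bs (A *\<^sub>v coords bs (orth_proj (span (set bs)) v))"

definition strong_limit ::
  "'i filter \<Rightarrow> ('i \<Rightarrow> 'a::real_normed_vector \<Rightarrow> 'a) \<Rightarrow> ('a \<Rightarrow> 'a) \<Rightarrow> bool" where
  "strong_limit F T L \<longleftrightarrow> bounded_linear L \<and> (\<forall>v. ((\<lambda>i. T i v) \<longlongrightarrow> L v) F)"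

text \<open>A possibly unbounded operator is given by its domain \<open>D\<close> and a function \<open>A\<close> whose values outside
  \<open>D\<close> are irrelevant. The last clause says that \<open>A\<close> equals its adjoint, including the domains.\<close>

definition self_adjoint_operator :: "'a::real_inner set \<Rightarrow> ('a \<Rightarrow> 'a) \<Rightarrow> bool" where
  "self_adjoint_operator D A \<longleftrightarrow>
     subspace D \<and> closure D = UNIV \<and>
     (\<forall>x\<in>D. \<forall>y\<in>D. A (x + y) = A x + A y) \<and>
     (\<forall>c. \<forall>x\<in>D. A (c *\<^sub>R x) = c *\<^sub>R A x) \<and>
     (\<forall>y w. (y \<in> D \<and> A y = w) \<longleftrightarrow> (\<forall>x\<in>D. inner (A x) y = inner x w))"

text \<open>The matrices \<open>E j\<close> discretize the operator \<open>A\<close> with domain \<open>D\<close>: for every \<open>v\<close>, the discrete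
  solutions with coordinate vectors \<open>x\<close> given by \<open>E j x = b\<close>, where \<open>b\<close> is the load vector with
  entries \<open>inner v (bs j ! k)\<close>, converge to the solution \<open>u\<close> of \<open>A u = v\<close>. The load vector is the Gram
  matrix applied to the coordinates of the orthogonal projection of \<open>v\<close>. For instance, Galerkin
  matrices \<open>E = \<beta> K + M\<close> discretize \<open>-\<beta> \<Delta> + I\<close> in this sense.\<close>

definition discretizes ::
  "'j filter \<Rightarrow> ('j \<Rightarrow> 'a::real_inner list) \<Rightarrow> ('j \<Rightarrow> real mat) \<Rightarrow> 'a set \<Rightarrow> ('a \<Rightarrow> 'a) \<Rightarrow> bool" where
  "discretizes F bs E D A \<longleftrightarrow>
     bij_betw A D UNIV \<and>
     strong_limit F (\<lambda>j. coord_op (bs j) (mat_inv (E j) * gram (bs j))) (inv_into D A)"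

section \<open>Covariance matrices\<close>

text \<open>\<open>prior_cov\<close> and \<open>theta_cov\<close> are the matrices written as inverses \<open>W\<^sup>-\<^sup>1\<close>; the arguments
  \<open>Cu\<close> and \<open>Cz\<close> below stand for the covariance matrices of the two factors.\<close>

definition prior_cov :: "real \<Rightarrow> real mat \<Rightarrow> real mat \<Rightarrow> real mat" where
  "prior_cov \<alpha> E M = \<alpha> \<cdot>\<^sub>m (mat_inv E * M * mat_inv E)"

definition theta_gram :: "real mat \<Rightarrow> real mat \<Rightarrow> real mat" where
  "theta_gram Mu Mz =
     (let nu = dim_row Mu; nz = dim_row Mz in
      four_block_mat Mu (0\<^sub>m nu (nu * nz)) (0\<^sub>m (nu * nz) nu) (kron Mu Mz))"

definition theta_cov :: "real mat \<Rightarrow> real mat \<Rightarrow> real mat \<Rightarrow> real vec \<Rightarrow> real mat" where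
  "theta_cov Cu Cz Mz z =
     four_block_mat
       ((1 + scalar_prod z ((Mz * Cz * Mz) *\<^sub>v z)) \<cdot>\<^sub>m Cu)
       (- kron Cu (mat_of_row z * Mz * Cz))
       (- kron Cu (Cz * Mz * mat_of_cols (dim_vec z) [z]))
       (kron Cu Cz)"

end

theory Submission
  imports
    Defs
    "Jordan_Normal_Form.Schur_Decomposition"
    "HOL-Analysis.Convex"
begin

text \<open>
  The diagonal blocks of the prior covariance \<open>C\<^sub>\<theta>\<close> are a multiple of \<open>C\<^sub>u\<close> and the Kronecker
  product of \<open>C\<^sub>u\<close> and \<open>C\<^sub>z\<close>, and the Gram matrix \<open>M\<^sub>\<theta>\<close> is block diagonal. So the
  off-diagonal blocks drop out of the trace of \<open>M\<^sub>\<theta> C\<^sub>\<theta>\<close>, and traces multiply over Kronecker products, so (lemma \<open>weighted_trace_theta\<close>)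
  \<open>Tr (M\<^sub>\<theta> C\<^sub>\<theta>) = Tr (M\<^sub>u C\<^sub>u) (1 + z\<^sup>T M\<^sub>z C\<^sub>z M\<^sub>z z + Tr (M\<^sub>z C\<^sub>z))\<close>.
  The two traces on the right converge by hypothesis, so everything rests on the quadratic form.

  Write \<open>z\<close> also for the element of the Hilbert space with coordinates \<open>z\<close>, and let \<open>R\<close> be the
  discrete solution operator with coordinate matrix \<open>E\<^sup>-\<^sup>1 M\<close>. As
  \<open>C = \<alpha> E\<^sup>-\<^sup>1 M E\<^sup>-\<^sup>1\<close>, the quadratic form equals \<open>\<alpha> \<parallel>R z\<parallel>\<^sup>2\<close>
  (lemma \<open>prior_cov_quadratic_form\<close>). The operators \<open>R\<close> converge strongly to the inverse of the
  differential operator, but here the argument \<open>z\<close> varies along the refinement as well. For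
  general filters the uniform boundedness principle is not available to bridge this gap. The
  trace hypothesis bridges it instead: \<open>\<alpha>\<close> times the squared Hilbert-Schmidt norm of \<open>R\<close> is
  \<open>Tr(M C)\<close>, so \<open>\<alpha> \<parallel>R (z - z')\<parallel>\<^sup>2 \<le> Tr(M C) \<parallel>z - z'\<parallel>\<^sup>2\<close> with a factor that converges and is
  therefore bounded in the limit (lemma \<open>coord_op_prior_error_le\<close>). Hence \<open>R z\<close> converges, and so
  does its squared norm.

  The weighted trace is defined with the positive square root of the Gram matrix. Passing from it
  to the trace of \<open>M C\<close>, and identifying \<open>Tr(M C)\<close> with a Hilbert-Schmidt norm, requires that a
  symmetric positive definite matrix has exactly one such root (lemma \<open>mat_sqrt\<close>).
\<close>

section \<open>Symmetric positive definite matrices\<close>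

lemma sym_pos_defI:
  assumes "A \<in> carrier_mat n n" and "transpose_mat A = A"
    and "\<And>x. x \<in> carrier_vec n \<Longrightarrow> x \<noteq> 0\<^sub>v n \<Longrightarrow> x \<bullet> (A *\<^sub>v x) > 0"
  shows "sym_pos_def A"
  using assms unfolding sym_pos_def_def by auto

lemma sym_pos_defD:
  assumes "sym_pos_def A" and "A \<in> carrier_mat n n"
  shows "transpose_mat A = A"
    and "x \<in> carrier_vec n \<Longrightarrow> x \<noteq> 0\<^sub>v n \<Longrightarrow> x \<bullet> (A *\<^sub>v x) > 0"
    and "x \<in> carrier_vec n \<Longrightarrow> x \<bullet> (A *\<^sub>v x) \<ge> 0"
proof -
  show "transpose_mat A = A"
    and *: "x \<in> carrier_vec n \<Longrightarrow> x \<noteq> 0\<^sub>v n \<Longrightarrow> x \<bullet> (A *\<^sub>v x) > 0"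
    using assms unfolding sym_pos_def_def by auto
  show "x \<bullet> (A *\<^sub>v x) \<ge> 0" if "x \<in> carrier_vec n"
    using that * assms(2) by (cases "x = 0\<^sub>v n") (auto simp: less_imp_le)
qed

lemma symmetric_scalar_prod:
  fixes A :: "'a :: comm_semiring_0 mat"
  assumes "A \<in> carrier_mat n n" and "transpose_mat A = A"
    and "x \<in> carrier_vec n" and "y \<in> carrier_vec n"
  shows "(A *\<^sub>v y) \<bullet> x = y \<bullet> (A *\<^sub>v x)"
  using transpose_vec_mult_scalar[OF assms(1,3,4)] assms(2) by simp

lemma real_scalar_prod_self:
  fixes x :: "real vec"
  shows "x \<bullet> x \<ge> 0" and "x \<bullet> x = 0 \<longleftrightarrow> x = 0\<^sub>v (dim_vec x)"
proof -
  have e: "x \<bullet> x = (\<Sum>i\<in>{0..<dim_vec x}. (x $ i)\<^sup>2)"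
    by (simp add: scalar_prod_def power2_eq_square)
  show "x \<bullet> x \<ge> 0" unfolding e by (simp add: sum_nonneg)
  show "x \<bullet> x = 0 \<longleftrightarrow> x = 0\<^sub>v (dim_vec x)"
  proof
    assume "x \<bullet> x = 0"
    hence "\<forall>i<dim_vec x. x $ i = 0" unfolding e by (subst (asm) sum_nonneg_eq_0_iff) auto
    thus "x = 0\<^sub>v (dim_vec x)" by (intro eq_vecI) auto
  next
    assume "x = 0\<^sub>v (dim_vec x)"
    thus "x \<bullet> x = 0" by (metis scalar_prod_right_zero carrier_vecI carrier_vec_dim_vec)
  qed
qed

text \<open>Positivity makes the kernel trivial, hence the determinant nonzero.\<close>

lemma sym_pos_def_inverse:
  assumes "sym_pos_def A" and A: "A \<in> carrier_mat n n"
  shows "mat_inv A \<in> carrier_mat n n"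
    and "A * mat_inv A = 1\<^sub>m n" and "mat_inv A * A = 1\<^sub>m n"
    and "transpose_mat (mat_inv A) = mat_inv A"
proof -
  have "det A \<noteq> 0"
  proof
    assume "det A = 0"
    then obtain v where v: "v \<in> carrier_vec n" "v \<noteq> 0\<^sub>v n" "A *\<^sub>v v = 0\<^sub>v n"
      using det_0_iff_vec_prod_zero_field[OF A] by blast
    with sym_pos_defD(2)[OF assms v(1,2)] show False by simp
  qed
  from det_non_zero_imp_unit[OF A this] mat_inverse(1)[OF A]
  obtain B where B: "mat_inverse A = Some B" by fastforce
  from mat_inverse(2)[OF A this] B
  show c: "mat_inv A \<in> carrier_mat n n" and r: "A * mat_inv A = 1\<^sub>m n"
    and l: "mat_inv A * A = 1\<^sub>m n" by auto
  let ?T = "transpose_mat (mat_inv A)"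
  have T: "?T \<in> carrier_mat n n" using c by simp
  have "?T * A = transpose_mat (A * mat_inv A)"
    using transpose_mult[OF A c] sym_pos_defD(1)[OF assms] by simp
  hence TA: "?T * A = 1\<^sub>m n" by (simp add: r)
  have "?T = ?T * (A * mat_inv A)" using T r by simp
  also have "\<dots> = (?T * A) * mat_inv A" using assoc_mult_mat[OF T A c] by simp
  finally show "?T = mat_inv A" using TA c by simp
qed

lemma sym_pos_def_congruence:
  assumes "sym_pos_def A" and A: "A \<in> carrier_mat n n"
    and P: "P \<in> carrier_mat n n" and Q: "Q \<in> carrier_mat n n" and QP: "Q * P = 1\<^sub>m n"
  shows "sym_pos_def (transpose_mat P * A * P)"
proof (rule sym_pos_defI[of _ n])
  have T: "transpose_mat P \<in> carrier_mat n n" using P by simp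
  have AP: "A * P \<in> carrier_mat n n" using A P by simp
  show "transpose_mat P * A * P \<in> carrier_mat n n" using T A P by auto
  have "transpose_mat (transpose_mat P * A * P) = transpose_mat P * (transpose_mat (transpose_mat P * A))"
    using transpose_mult[of "transpose_mat P * A" n n P n] T A P by simp
  also have "transpose_mat (transpose_mat P * A) = A * P"
    using transpose_mult[OF T A] sym_pos_defD(1)[OF assms(1) A] by simp
  finally show "transpose_mat (transpose_mat P * A * P) = transpose_mat P * A * P"
    using assoc_mult_mat[OF T A P] by simp
  fix x :: "real vec" assume x: "x \<in> carrier_vec n" "x \<noteq> 0\<^sub>v n"
  have Px: "P *\<^sub>v x \<in> carrier_vec n" using P x by simp
  have "P *\<^sub>v x \<noteq> 0\<^sub>v n"
  proof
    assume "P *\<^sub>v x = 0\<^sub>v n"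
    hence "Q *\<^sub>v (P *\<^sub>v x) = 0\<^sub>v n" using Q by auto
    thus False using assoc_mult_mat_vec[OF Q P x(1)] QP x by simp
  qed
  from sym_pos_defD(2)[OF assms(1) A Px this]
  have "0 < (P *\<^sub>v x) \<bullet> (A *\<^sub>v (P *\<^sub>v x))" .
  also have "\<dots> = x \<bullet> (transpose_mat P *\<^sub>v (A *\<^sub>v (P *\<^sub>v x)))"
    using transpose_vec_mult_scalar[OF T, of "A *\<^sub>v (P *\<^sub>v x)" x] A Px x by simp
  also have "transpose_mat P *\<^sub>v (A *\<^sub>v (P *\<^sub>v x)) = (transpose_mat P * A * P) *\<^sub>v x"
    using assoc_mult_mat_vec[OF T A Px] assoc_mult_mat_vec[OF _ P x(1), of "transpose_mat P * A" n] T A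
    by simp
  finally show "0 < x \<bullet> ((transpose_mat P * A * P) *\<^sub>v x)" .
qed

lemma four_block_diag_mult:
  assumes "A \<in> carrier_mat n n" "D \<in> carrier_mat m m" "A' \<in> carrier_mat n n" "D' \<in> carrier_mat m m"
  shows "four_block_mat A (0\<^sub>m n m) (0\<^sub>m m n) D * four_block_mat A' (0\<^sub>m n m) (0\<^sub>m m n) D'
    = four_block_mat (A * A') (0\<^sub>m n m) (0\<^sub>m m n) (D * (D' :: 'a :: comm_ring_1 mat))"
  by (subst mult_four_block_mat[OF assms(1) _ _ assms(2) assms(3) _ _ assms(4)], use assms in auto)

lemma sym_pos_def_four_block:
  assumes "sym_pos_def A" and A: "A \<in> carrier_mat n n" and "sym_pos_def D" and D: "D \<in> carrier_mat m m"
  shows "sym_pos_def (four_block_mat A (0\<^sub>m n m) (0\<^sub>m m n) D)" (is "sym_pos_def ?B")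
proof (rule sym_pos_defI[of _ "n + m"])
  show "?B \<in> carrier_mat (n + m) (n + m)" using A D by simp
  show "transpose_mat ?B = ?B"
    using transpose_four_block_mat[OF A zero_carrier_mat zero_carrier_mat D]
      sym_pos_defD(1)[OF assms(1) A] sym_pos_defD(1)[OF assms(3) D] by simp
  fix x :: "real vec" assume x: "x \<in> carrier_vec (n + m)" "x \<noteq> 0\<^sub>v (n + m)"
  define y z where "y = vec_first x n" and "z = vec_last x m"
  have c: "y \<in> carrier_vec n" "z \<in> carrier_vec m" by (auto simp: y_def z_def)
  have xe: "x = y @\<^sub>v z" using x(1) by (simp add: y_def z_def)
  have "y \<noteq> 0\<^sub>v n \<or> z \<noteq> 0\<^sub>v m"
    using x(2) unfolding xe by auto
  moreover have "x \<bullet> (?B *\<^sub>v x) = y \<bullet> (A *\<^sub>v y) + z \<bullet> (D *\<^sub>v z)"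
    unfolding xe mult_mat_vec_split[OF A D c] by (rule scalar_prod_append) (use A D c in auto)
  ultimately show "x \<bullet> (?B *\<^sub>v x) > 0"
    using sym_pos_defD(2,3)[OF assms(1) A c(1)] sym_pos_defD(2,3)[OF assms(3) D c(2)]
    by (smt (verit))
qed

section \<open>Square roots of symmetric positive definite matrices\<close>

text \<open>Over the complex numbers the characteristic polynomial has a root. Moving the symmetric real
  matrix across the Hermitian form \<open>conjugate v \<bullet> v\<close> shows that this root is its own conjugate, so
  it is a root of the real characteristic polynomial.\<close>

lemma symmetric_has_real_eigenvector:
  fixes A :: "real mat"
  assumes A: "A \<in> carrier_mat n n" and sym: "transpose_mat A = A" and n: "n > 0"
  obtains v e where "v \<in> carrier_vec n" "v \<noteq> 0\<^sub>v n" "A *\<^sub>v v = e \<cdot>\<^sub>v v"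
proof -
  define C where "C = map_mat complex_of_real A"
  have C: "C \<in> carrier_mat n n" using A by (simp add: C_def)
  obtain as where as: "char_poly C = (\<Prod>a\<leftarrow>as. [:- a, 1:])" "length as = n"
    using char_poly_factorized[OF C] by blast
  from as(2) n obtain e where "e \<in> set as" by (cases as) auto
  hence root: "poly (char_poly C) e = 0" unfolding as(1) by (simp add: poly_prod_list prod_list_zero_iff  o_def)
  then obtain v where v: "v \<in> carrier_vec n" "v \<noteq> 0\<^sub>v n" "C *\<^sub>v v = e \<cdot>\<^sub>v v"
    using eigenvalue_root_char_poly[OF C] C unfolding eigenvalue_def eigenvector_def by auto
  have symC: "transpose_mat C = C" unfolding C_def using sym by (metis map_mat_transpose)
  let ?w = "conjugate v"
  have w: "?w \<in> carrier_vec n" using v by simp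
  have "C *\<^sub>v ?w = conjugate (C *\<^sub>v v)"
  proof (rule eq_vecI)
    fix i assume "i < dim_vec (conjugate (C *\<^sub>v v))"
    thus "(C *\<^sub>v ?w) $ i = conjugate (C *\<^sub>v v) $ i"
      using v(1) C A by (simp add: scalar_prod_def C_def)
  qed (use C in simp)
  also have "\<dots> = cnj e \<cdot>\<^sub>v ?w" by (simp add: v(3) conjugate_smult_vec)
  finally have Cw: "C *\<^sub>v ?w = cnj e \<cdot>\<^sub>v ?w" .
  have "cnj e * (?w \<bullet> v) = e * (?w \<bullet> v)"
    using symmetric_scalar_prod[OF C symC v(1) w] v w by (simp add: Cw)
  moreover have "?w \<bullet> v \<noteq> 0"
    using conjugate_square_eq_0_vec[OF v(1)] v comm_scalar_prod[OF v(1) w] by simp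
  ultimately have "cnj e = e" by simp
  then obtain r where r: "e = complex_of_real r" by (metis Reals_cnj_iff Reals_cases)
  have "poly (char_poly A) r = 0"
    using root unfolding C_def of_real_hom.char_poly_hom[OF A] r by simp
  then obtain u where "eigenvector A u r"
    using eigenvalue_root_char_poly[OF A] unfolding eigenvalue_def by blast
  thus thesis using that A unfolding eigenvector_def by auto
qed

text \<open>Gram-Schmidt applied to a basis that starts with \<open>v\<close> leaves \<open>v\<close> in first place. It yields
  orthogonal vectors that are not of unit length, so the columns are normalized afterwards.\<close>

lemma orthogonal_matrix_with_first_col:
  fixes v :: "real vec"
  assumes v: "v \<in> carrier_vec n" "v \<noteq> 0\<^sub>v n"
  obtains P c where "P \<in> carrier_mat n n" "transpose_mat P * P = 1\<^sub>m n"
    "col P 0 = c \<cdot>\<^sub>v v"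
proof -
  interpret cof_vec_space n "TYPE(real)" .
  define b where "b = basis_completion v"
  from basis_completion[OF v, folded b_def]
  have b: "set b \<subseteq> carrier_vec n" "distinct b" "\<not> lin_dep (set b)" "hd b = v" "length b = n" 
    by auto
  define ws where "ws = gram_schmidt n b"
  from gram_schmidt_result[OF b(1-3) ws_def] 
  have ws: "set ws \<subseteq> carrier_vec n" "corthogonal ws" "length ws = n" by (auto simp: b)
  have n0: "n \<noteq> 0" using v by auto
  then obtain vs where "b = v # vs" using b by (cases b) auto
  with gram_schmidt_hd[OF v(1)] have hd: "ws ! 0 = v" 
    unfolding ws_def by (metis hd_conv_nth length_0_conv n0 ws(3) ws_def)
  \<comment> \<open>Normalizing factors; they are defined since an orthogonal list contains no zero vector.\<close>
  define s where "s i = 1 / sqrt (ws ! i \<bullet> ws ! i)" for i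
  define P where "P = mat_of_cols n (map (\<lambda>i. s i \<cdot>\<^sub>v ws ! i) [0..<n])"
  have wi: "ws ! i \<in> carrier_vec n" if "i < n" for i using ws that by auto
  have P: "P \<in> carrier_mat n n" by (auto simp: P_def)
  have col: "col P i = s i \<cdot>\<^sub>v ws ! i" if "i < n" for i
    unfolding P_def using that wi by (subst col_mat_of_cols) auto
  have "transpose_mat P * P = 1\<^sub>m n"
  proof (rule eq_matI)
    fix i j assume "i < dim_row (1\<^sub>m n)" "j < dim_col (1\<^sub>m n)"
    hence ij: "i < n" "j < n" by auto
    have "(transpose_mat P * P) $$ (i, j) = s i * s j * (ws ! i \<bullet> ws ! j)"
      using ij P wi[of i] wi[of j] by (simp add: col)
    also have "\<dots> = (if i = j then 1 else 0)"
    proof (cases "i = j")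
      case True
      have "ws ! i \<bullet> ws ! i \<noteq> 0" using corthogonalD[OF ws(2), of i i] ij ws(3) by (simp add: conjugate_vec_def vec_eq_iff)
      with real_scalar_prod_self(1)[of "ws ! i"] have "ws ! i \<bullet> ws ! i > 0" by linarith
      thus ?thesis using True by (simp add: s_def)
    next
      case False
      have "conjugate (ws ! j) = ws ! j" by (rule eq_vecI) auto
      with False show ?thesis using corthogonalD[OF ws(2), of i j] ij ws(3) by simp
    qed
    finally show "(transpose_mat P * P) $$ (i, j) = 1\<^sub>m n $$ (i, j)" using ij by simp
  qed (use P in auto)
  moreover have "col P 0 = s 0 \<cdot>\<^sub>v v" using col[of 0] hd n0 by simp
  ultimately show thesis using that P by blast
qed

text \<open>Induction on the dimension: an orthogonal change of basis whose first vector is an eigenvector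
  splits off a positive \<open>1 \<times> 1\<close> block, the root is taken blockwise, and the basis change is
  undone.\<close>

lemma sym_pos_def_sqrt_exists:
  assumes "sym_pos_def A" and "A \<in> carrier_mat n n"
  shows "\<exists>S \<in> carrier_mat n n. sym_pos_def S \<and> S * S = A"
  using assms
proof (induction n arbitrary: A)
  case 0
  then show ?case by (intro bexI[of _ A]) (auto intro!: eq_matI)
next
  case (Suc n A)
  note A = Suc.prems(2) and spdA = Suc.prems(1)
  obtain v e where v: "v \<in> carrier_vec (Suc n)" "v \<noteq> 0\<^sub>v (Suc n)" "A *\<^sub>v v = e \<cdot>\<^sub>v v"
    using symmetric_has_real_eigenvector[OF A sym_pos_defD(1)[OF spdA A]] by blast
  obtain P c where P: "P \<in> carrier_mat (Suc n) (Suc n)" and PP: "transpose_mat P * P = 1\<^sub>m (Suc n)"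
    and P0: "col P 0 = c \<cdot>\<^sub>v v"
    using orthogonal_matrix_with_first_col[OF v(1,2)] by blast
  define T where "T = transpose_mat P"
  have T: "T \<in> carrier_mat (Suc n) (Suc n)" and TT: "transpose_mat T = P" using P by (auto simp: T_def)
  have TP: "T * P = 1\<^sub>m (Suc n)" using PP by (simp add: T_def)
  have PT: "P * T = 1\<^sub>m (Suc n)" using mat_mult_left_right_inverse[OF T P TP] .
  define B where "B = T * A * P"
  have B: "B \<in> carrier_mat (Suc n) (Suc n)" using T A P by (simp add: B_def)
  have spdB: "sym_pos_def B"
    unfolding B_def T_def by (rule sym_pos_def_congruence[OF spdA A P T TP])
  have TA: "T * A \<in> carrier_mat (Suc n) (Suc n)" using T A by simp
  have "col B 0 = (T * A) *\<^sub>v col P 0" unfolding B_def using TA P by (subst col_mult2[of _ "Suc n" "Suc n" _ "Suc n"]) auto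
  also have "\<dots> = T *\<^sub>v (A *\<^sub>v (c \<cdot>\<^sub>v v))" using assoc_mult_mat_vec[OF T A] v P0 by simp
  also have "A *\<^sub>v (c \<cdot>\<^sub>v v) = e \<cdot>\<^sub>v col P 0"
    using mult_mat_vec[OF A v(1)] v(3) P0 by (simp add: smult_smult_assoc mult.commute)
  also have "T *\<^sub>v (e \<cdot>\<^sub>v col P 0) = e \<cdot>\<^sub>v (T *\<^sub>v col P 0)"
    by (rule mult_mat_vec[OF T]) (use P0 v in simp)
  also have "T *\<^sub>v col P 0 = col (T * P) 0" using T P by (subst col_mult2[of _ "Suc n" "Suc n" _ "Suc n"]) auto
  finally have colB: "col B 0 = e \<cdot>\<^sub>v unit_vec (Suc n) 0" by (simp add: TP)
  have B0: "B $$ (i, 0) = (if i = 0 then e else 0)" if "i < Suc n" for i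
    using arg_cong[OF colB, of "\<lambda>x. x $ i"] that B by auto
  have B0': "B $$ (0, i) = (if i = 0 then e else 0)" if "i < Suc n" for i
    using B0[OF that] sym_pos_defD(1)[OF spdB B] that B by (metis carrier_matD index_transpose_mat(1) zero_less_Suc)
  define A' where "A' = mat n n (\<lambda>(i, j). B $$ (Suc i, Suc j))"
  define L where "L = mat 1 1 (\<lambda>_. e)"
  have A': "A' \<in> carrier_mat n n" and L: "L \<in> carrier_mat 1 1" by (auto simp: A'_def L_def)
  \<comment> \<open>The eigenvector fixes the first column of \<open>B\<close>, and symmetry then fixes the first row.\<close>
  have Bblock: "B = four_block_mat L (0\<^sub>m 1 n) (0\<^sub>m n 1) A'"
    by (rule eq_matI) (use B A' L B0 B0' in \<open>auto simp: A'_def L_def not_less\<close>)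
  have split: "(y @\<^sub>v x) \<bullet> (B *\<^sub>v (y @\<^sub>v x)) = y \<bullet> (L *\<^sub>v y) + x \<bullet> (A' *\<^sub>v x)"
    if "y \<in> carrier_vec 1" "x \<in> carrier_vec n" for y x :: "real vec"
    unfolding Bblock mult_mat_vec_split[OF L A' that] by (rule scalar_prod_append) (use A' L that in auto)
  have "e > 0"
  proof -
    have u: "unit_vec (Suc n) 0 \<in> carrier_vec (Suc n)" "unit_vec (Suc n) 0 \<noteq> (0\<^sub>v (Suc n) :: real vec)"
      by (auto simp: vec_eq_iff)
    have "unit_vec (Suc n) 0 \<bullet> (B *\<^sub>v unit_vec (Suc n) 0) = B $$ (0,0)"
      using B by (simp add: scalar_prod_left_unit[of _ "Suc n"])
    thus ?thesis using sym_pos_defD(2)[OF spdB B u] B0[of 0] by simp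
  qed
  have spdA': "sym_pos_def A'"
  proof (rule sym_pos_defI[OF A'])
    show "transpose_mat A' = A'"
    proof (rule eq_matI)
      fix i j assume "i < dim_row A'" "j < dim_col A'"
      hence ij: "i < n" "j < n" using A' by auto
      have "B $$ (Suc j, Suc i) = B $$ (Suc i, Suc j)"
        using sym_pos_defD(1)[OF spdB B] ij B by (metis Suc_less_eq carrier_matD index_transpose_mat(1))
      thus "transpose_mat A' $$ (i, j) = A' $$ (i, j)" using ij by (simp add: A'_def)
    qed (auto simp: A'_def)
    fix x :: "real vec" assume x: "x \<in> carrier_vec n" "x \<noteq> 0\<^sub>v n"
    have "0\<^sub>v 1 @\<^sub>v x \<noteq> 0\<^sub>v (Suc n)"
    proof
      assume "0\<^sub>v 1 @\<^sub>v x = 0\<^sub>v (Suc n)"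
      hence "0\<^sub>v 1 @\<^sub>v x = 0\<^sub>v 1 @\<^sub>v 0\<^sub>v n" by auto
      with x show False by (metis append_vec_eq zero_carrier_vec)
    qed
    moreover have "0\<^sub>v 1 @\<^sub>v x \<in> carrier_vec (Suc n)"
      using append_carrier_vec[OF zero_carrier_vec[of 1] x(1)] by simp
    moreover have "0\<^sub>v 1 \<bullet> (L *\<^sub>v 0\<^sub>v 1) = 0" using L by simp
    ultimately show "x \<bullet> (A' *\<^sub>v x) > 0"
      using sym_pos_defD(2)[OF spdB B] split[of "0\<^sub>v 1" x] x by fastforce
  qed
  from Suc.IH[OF this A'] obtain S' where S': "S' \<in> carrier_mat n n" "sym_pos_def S'" "S' * S' = A'"
    by blast
  define K where "K = mat 1 1 (\<lambda>_. sqrt e)"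
  have K: "K \<in> carrier_mat 1 1" by (simp add: K_def)
  have KK: "K * K = L" by (rule eq_matI) (use \<open>e > 0\<close> in \<open>auto simp: K_def L_def scalar_prod_def\<close>)
  have spdK: "sym_pos_def K"
  proof (rule sym_pos_defI[OF K])
    fix x :: "real vec" assume x: "x \<in> carrier_vec 1" "x \<noteq> 0\<^sub>v 1"
    hence "x $ 0 \<noteq> 0" by (auto simp: vec_eq_iff)
    moreover have "x \<bullet> (K *\<^sub>v x) = sqrt e * (x $ 0)\<^sup>2"
      using x by (simp add: scalar_prod_def K_def power2_eq_square)
    ultimately show "x \<bullet> (K *\<^sub>v x) > 0" using \<open>e > 0\<close> by simp
  qed (auto simp: K_def intro!: eq_matI)
  define R where "R = four_block_mat K (0\<^sub>m 1 n) (0\<^sub>m n 1) S'"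
  have R: "R \<in> carrier_mat (Suc n) (Suc n)" using four_block_carrier_mat[OF K S'(1)] by (simp add: R_def)
  have RR: "R * R = B"
    unfolding R_def four_block_diag_mult[OF K S'(1) K S'(1)] KK S'(3) Bblock ..
  have spdR: "sym_pos_def R"
    unfolding R_def by (rule sym_pos_def_four_block[OF spdK K S'(2,1)])
  define S where "S = P * R * T"
  have spdS: "sym_pos_def S"
    using sym_pos_def_congruence[OF spdR R T P PT] unfolding TT S_def .
  have S: "S \<in> carrier_mat (Suc n) (Suc n)" using P R T by (simp add: S_def)
  note assoc = assoc_mult_mat[of _ "Suc n" "Suc n" _ "Suc n" _ "Suc n"]
  have "S * S = P * (R * ((T * P) * (R * T)))" 
    unfolding S_def using P R T by (simp add: assoc)
  also have "\<dots> = P * (B * T)" unfolding TP RR[symmetric] using P R T by (simp add: assoc)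
  also have "\<dots> = (P * T) * (A * (P * T))" unfolding B_def using P A T by (simp add: assoc)
  also have "\<dots> = A" unfolding PT using A by simp
  finally show ?case using S spdS by blast
qed

lemma mat_trace_mult_commute:
  assumes "A \<in> carrier_mat n m" and "B \<in> carrier_mat m n"
  shows "mat_trace (A * B) = mat_trace (B * A)"
proof -
  have "mat_trace (A * B) = (\<Sum>i<n. \<Sum>j<m. A $$ (i, j) * B $$ (j, i))"
    using assms by (simp add: mat_trace_def scalar_prod_def lessThan_atLeast0)
  also have "\<dots> = (\<Sum>j<m. \<Sum>i<n. B $$ (j, i) * A $$ (i, j))"
    by (subst sum.swap) (simp add: mult.commute)
  also have "\<dots> = mat_trace (B * A)"
    using assms by (simp add: mat_trace_def scalar_prod_def lessThan_atLeast0)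
  finally show ?thesis .
qed

text \<open>With \<open>D = S - T\<close> and \<open>P = S + T\<close>, the hypothesis \<open>S\<^sup>2 = T\<^sup>2\<close> says that \<open>P\<close> and \<open>D\<close>
  anticommute. Then \<open>D P D\<close> has trace zero, while its diagonal entries are the values of the
  positive definite form \<open>P\<close> at the columns of \<open>D\<close>. So all these columns vanish.\<close>

lemma sym_pos_def_sqrt_unique:
  assumes "sym_pos_def S" and S: "S \<in> carrier_mat n n"
    and "sym_pos_def T" and T: "T \<in> carrier_mat n n" and eq: "S * S = T * T"
  shows "S = T"
proof -
  define D P where "D = S - T" and "P = S + T"
  have D: "D \<in> carrier_mat n n" and P: "P \<in> carrier_mat n n" using S T by (auto simp: D_def P_def)
  have symD: "transpose_mat D = D"
    using transpose_minus[OF S T] sym_pos_defD(1)[OF assms(1) S] sym_pos_defD(1)[OF assms(3) T]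
    by (simp add: D_def)
  have spdP: "sym_pos_def P"
  proof (rule sym_pos_defI[OF P])
    show "transpose_mat P = P"
      using transpose_add[OF S T] sym_pos_defD(1)[OF assms(1) S] sym_pos_defD(1)[OF assms(3) T]
      by (simp add: P_def)
    fix x :: "real vec" assume x: "x \<in> carrier_vec n" "x \<noteq> 0\<^sub>v n"
    have "x \<bullet> (P *\<^sub>v x) = x \<bullet> (S *\<^sub>v x) + x \<bullet> (T *\<^sub>v x)"
      unfolding P_def add_mult_distrib_mat_vec[OF S T x(1)]
      by (rule scalar_prod_add_distrib) (use S T x in auto)
    thus "x \<bullet> (P *\<^sub>v x) > 0"
      using sym_pos_defD(2)[OF assms(1) S x] sym_pos_defD(2)[OF assms(3) T x] by simp
  qed
  have cS: "S * T \<in> carrier_mat n n" "T * S \<in> carrier_mat n n" "T * T \<in> carrier_mat n n" using S T by auto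
  have "P * D = (S * S - S * T) + (T * S - T * T)"
    unfolding P_def D_def using S T
    by (simp add: add_mult_distrib_mat[of _ n n _ _ n] mult_minus_distrib_mat[of _ n n _ n])
      (rule eq_matI, auto)
  moreover have "D * P = (S * S - T * S) + (S * T - T * T)"
    unfolding P_def D_def using S T
    by (simp add: minus_mult_distrib_mat[of _ n n _ _ n] mult_add_distrib_mat[of _ n n _ n])
      (rule eq_matI, auto)
  ultimately have anti: "P * D = - (D * P)"
    unfolding eq by (intro eq_matI) (use cS S T in auto)
  have DP: "D * P \<in> carrier_mat n n" and PD: "P * D \<in> carrier_mat n n" using D P by auto
  have "mat_trace (D * (P * D)) = mat_trace ((P * D) * D)"
    by (rule mat_trace_mult_commute[OF D PD])
  also have "\<dots> = mat_trace (- ((D * P) * D))" unfolding anti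
    by (rule arg_cong[of _ _ mat_trace], rule eq_matI) (use DP D in \<open>auto simp: scalar_prod_def sum_negf\<close>)
  also have "\<dots> = - mat_trace ((D * P) * D)" using DP D by (simp add: mat_trace_def sum_negf)
  also have "(D * P) * D = D * (P * D)" using assoc_mult_mat[OF D P D] .
  finally have "mat_trace (D * (P * D)) = 0" by simp
  moreover have diag: "(D * (P * D)) $$ (i, i) = col D i \<bullet> (P *\<^sub>v col D i)" if "i < n" for i
  proof -
    have "row D i = col D i" using row_transpose[of i D] symD that D by simp
    thus ?thesis using that D P PD by (simp add: col_mult2[OF P D])
  qed
  ultimately have sum0: "(\<Sum>i<n. col D i \<bullet> (P *\<^sub>v col D i)) = 0"
    using D by (simp add: mat_trace_def del: index_mult_mat(1))
  have colc: "col D i \<in> carrier_vec n" for i using D by auto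
  have "col D i = 0\<^sub>v n" if "i < n" for i
  proof -
    have "col D i \<bullet> (P *\<^sub>v col D i) = 0"
      using sum0 sym_pos_defD(3)[OF spdP P colc] that by (subst (asm) sum_nonneg_eq_0_iff) auto
    thus ?thesis using sym_pos_defD(2)[OF spdP P colc] by (metis less_irrefl)
  qed
  hence "D $$ (i, j) = 0" if "i < n" "j < n" for i j
    using that D by (metis carrier_matD index_col index_zero_vec(1))
  thus "S = T"
    by (intro eq_matI) (use S T in \<open>force simp: D_def\<close>)+
qed

lemma mat_sqrt:
  assumes "sym_pos_def M" and M: "M \<in> carrier_mat n n"
  shows "mat_sqrt M \<in> carrier_mat n n" and "sym_pos_def (mat_sqrt M)" and "mat_sqrt M * mat_sqrt M = M"
proof -
  have carrier: "S \<in> carrier_mat n n" if "sym_pos_def S" "S * S = M" for S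
    using that M unfolding sym_pos_def_def by (metis carrier_matD(1) carrier_matI index_mult_mat(2))
  obtain S where S: "S \<in> carrier_mat n n" "sym_pos_def S" "S * S = M"
    using sym_pos_def_sqrt_exists[OF assms] by blast
  have "sym_pos_def (mat_sqrt M) \<and> mat_sqrt M * mat_sqrt M = M"
    unfolding mat_sqrt_def
  proof (rule theI[of _ S])
    fix T assume "sym_pos_def T \<and> T * T = M"
    thus "T = S" using sym_pos_def_sqrt_unique[of T n S] carrier S by metis
  qed (use S in simp)
  thus "sym_pos_def (mat_sqrt M)" "mat_sqrt M * mat_sqrt M = M" "mat_sqrt M \<in> carrier_mat n n"
    using carrier by blast+
qed

text \<open>Cyclicity of the trace removes the square root.\<close>

lemma weighted_trace_eq:
  assumes "sym_pos_def M" and M: "M \<in> carrier_mat n n" and C: "C \<in> carrier_mat n n"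
  shows "weighted_trace M C = mat_trace (M * C)"
proof -
  note S = mat_sqrt[OF assms(1,2)]
  let ?S = "mat_sqrt M"
  have "weighted_trace M C = mat_trace (?S * (?S * C))"
    unfolding weighted_trace_def using S C by (intro mat_trace_mult_commute) auto
  also have "?S * (?S * C) = M * C" using assoc_mult_mat[OF S(1) S(1) C] S(3) by simp
  finally show ?thesis .
qed

section \<open>Kronecker products and the trace on the parameter space\<close>

text \<open>Indices of a Kronecker product encode pairs by quotient and remainder; this turns sums over
  such indices into double sums.\<close>

lemma sum_div_mod:
  fixes f :: "nat \<Rightarrow> nat \<Rightarrow> 'a :: comm_monoid_add"
  shows "(\<Sum>k<m * n. f (k div n) (k mod n)) = (\<Sum>a<m. \<Sum>b<n. f a b)"
proof -
  have "(\<Sum>a<m. \<Sum>b<n. f a b) = (\<Sum>(a, b)\<in>{..<m} \<times> {..<n}. f a b)"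
    by (rule sum.cartesian_product)
  also have "\<dots> = (\<Sum>k<m * n. f (k div n) (k mod n))"
  proof (rule sum.reindex_bij_witness[of _ "\<lambda>k. (k div n, k mod n)" "\<lambda>(a, b). a * n + b"])
    fix k assume "k \<in> {..<m * n}"
    hence "k < m * n" by simp
    moreover from this have "n > 0" by (cases n) auto
    ultimately show "(k div n, k mod n) \<in> {..<m} \<times> {..<n}"
      by (simp add: less_mult_imp_div_less)
  next
    fix ab assume "ab \<in> {..<m} \<times> {..<n}"
    then obtain a b where ab: "ab = (a, b)" "a < m" "b < n" by auto
    have "a * n + b < a * n + n" using ab by simp
    also have "\<dots> \<le> m * n" using ab mult_le_mono1[of "Suc a" m n] by (simp add: add.commute)
    finally show "(case ab of (a, b) \<Rightarrow> a * n + b) \<in> {..<m * n}" by (simp add: ab)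
  qed auto
  finally show ?thesis ..
qed

lemma div_mod_less:
  assumes "(i::nat) < m * n"
  shows "i div n < m" and "i mod n < n"
proof -
  have "n > 0" using assms by (cases n) auto
  thus "i div n < m" "i mod n < n" using assms by (auto simp: less_mult_imp_div_less)
qed

lemma kron_carrier [simp]:
  "A \<in> carrier_mat r c \<Longrightarrow> B \<in> carrier_mat r' c' \<Longrightarrow> kron A B \<in> carrier_mat (r * r') (c * c')"
  by (auto simp: kron_def)

lemma index_kron:
  assumes "A \<in> carrier_mat r c" and "B \<in> carrier_mat r' c'" and "i < r * r'" and "j < c * c'"
  shows "kron A B $$ (i, j) = A $$ (i div r', j div c') * B $$ (i mod r', j mod c')"
  using assms by (simp add: kron_def)

lemma kron_mult:
  assumes A: "A \<in> carrier_mat r c" and B: "B \<in> carrier_mat r' c'"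
    and C: "C \<in> carrier_mat c d" and D: "D \<in> carrier_mat c' d'"
  shows "kron A B * kron C D = kron (A * C) (B * D)"
proof (rule eq_matI)
  have dims: "kron A B \<in> carrier_mat (r * r') (c * c')" "kron C D \<in> carrier_mat (c * c') (d * d')"
      "kron (A * C) (B * D) \<in> carrier_mat (r * r') (d * d')"
    using assms by auto
  show "dim_row (kron A B * kron C D) = dim_row (kron (A * C) (B * D))"
    "dim_col (kron A B * kron C D) = dim_col (kron (A * C) (B * D))" using dims by auto
  fix i j assume "i < dim_row (kron (A * C) (B * D))" "j < dim_col (kron (A * C) (B * D))"
  hence ij: "i < r * r'" "j < d * d'" using dims by auto
  note dm = div_mod_less[OF ij(1)] div_mod_less[OF ij(2)]
  let ?f = "\<lambda>a b. (A $$ (i div r', a) * C $$ (a, j div d')) * (B $$ (i mod r', b) * D $$ (b, j mod d'))"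
  have "(kron A B * kron C D) $$ (i, j) = (\<Sum>k<c * c'. kron A B $$ (i, k) * kron C D $$ (k, j))"
    using dims ij by (simp add: scalar_prod_def lessThan_atLeast0)
  also have "\<dots> = (\<Sum>k<c * c'. ?f (k div c') (k mod c'))"
    using ij by (intro sum.cong) (auto simp: index_kron[OF A B] index_kron[OF C D])
  also have "\<dots> = (\<Sum>a<c. A $$ (i div r', a) * C $$ (a, j div d')) * (\<Sum>b<c'. B $$ (i mod r', b) * D $$ (b, j mod d'))"
    unfolding sum_div_mod[of ?f] sum_product ..
  also have "\<dots> = (A * C) $$ (i div r', j div d') * (B * D) $$ (i mod r', j mod d')"
    using dm A B C D by (simp add: scalar_prod_def lessThan_atLeast0)
  also have "\<dots> = kron (A * C) (B * D) $$ (i, j)"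
    using index_kron[of "A * C" r d "B * D" r' d' i j] assms ij by auto
  finally show "(kron A B * kron C D) $$ (i, j) = kron (A * C) (B * D) $$ (i, j)" .
qed

lemma kron_one: "kron (1\<^sub>m m) (1\<^sub>m n) = 1\<^sub>m (m * n)"
proof (rule eq_matI)
  fix i j assume "i < dim_row (1\<^sub>m (m * n) :: real mat)" "j < dim_col (1\<^sub>m (m * n) :: real mat)"
  hence ij: "i < m * n" "j < m * n" by auto
  have "i = j \<longleftrightarrow> i div n = j div n \<and> i mod n = j mod n" by (metis div_mult_mod_eq)
  thus "kron (1\<^sub>m m) (1\<^sub>m n) $$ (i, j) = 1\<^sub>m (m * n) $$ (i, j)"
    using index_kron[of "1\<^sub>m m" m m "1\<^sub>m n" n n i j] ij div_mod_less[OF ij(1)] div_mod_less[OF ij(2)] by auto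
qed (auto simp: kron_def)

lemma transpose_kron:
  assumes A: "A \<in> carrier_mat r c" and B: "B \<in> carrier_mat r' c'"
  shows "transpose_mat (kron A B) = kron (transpose_mat A) (transpose_mat B)"
  by (rule eq_matI) (use A B in \<open>auto simp: kron_def div_mod_less\<close>)

lemma mat_trace_kron:
  assumes A: "A \<in> carrier_mat m m" and B: "B \<in> carrier_mat n n"
  shows "mat_trace (kron A B) = mat_trace A * mat_trace B"
proof -
  have "mat_trace (kron A B) = (\<Sum>k<m * n. A $$ (k div n, k div n) * B $$ (k mod n, k mod n))"
    using kron_carrier[OF A B] by (simp add: mat_trace_def index_kron[OF A B])
  also have "\<dots> = mat_trace A * mat_trace B"
    unfolding sum_div_mod[of "\<lambda>a b. A $$ (a, a) * B $$ (b, b)"] mat_trace_def using A B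
    by (simp add: sum_product)
  finally show ?thesis .
qed

text \<open>The mixed product rule exhibits \<open>kron A B\<close> as the square of the symmetric matrix
  \<open>K = kron (mat_sqrt A) (mat_sqrt B)\<close>. The Kronecker product of the two inverse
  roots inverts \<open>K\<close>, so the square is a congruence transform of the identity.\<close>

lemma sym_pos_def_kron:
  assumes "sym_pos_def A" and A: "A \<in> carrier_mat m m" and "sym_pos_def B" and B: "B \<in> carrier_mat n n"
  shows "sym_pos_def (kron A B)"
proof -
  note S = mat_sqrt[OF assms(1) A] and T = mat_sqrt[OF assms(3) B]
  define K where "K = kron (mat_sqrt A) (mat_sqrt B)"
  define Q where "Q = kron (mat_inv (mat_sqrt A)) (mat_inv (mat_sqrt B))"
  note iS = sym_pos_def_inverse[OF S(2,1)] and iT = sym_pos_def_inverse[OF T(2,1)]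
  have K: "K \<in> carrier_mat (m * n) (m * n)" and Q: "Q \<in> carrier_mat (m * n) (m * n)"
    using S T iS iT by (auto simp: K_def Q_def)
  have QK: "Q * K = 1\<^sub>m (m * n)"
    unfolding Q_def K_def kron_mult[OF iS(1) iT(1) S(1) T(1)] iS(3) iT(3) kron_one ..
  have one: "sym_pos_def (1\<^sub>m (m * n))"
  proof (rule sym_pos_defI[OF one_carrier_mat])
    fix x :: "real vec" assume x: "x \<in> carrier_vec (m * n)" "x \<noteq> 0\<^sub>v (m * n)"
    show "x \<bullet> (1\<^sub>m (m * n) *\<^sub>v x) > 0"
      using real_scalar_prod_self[of x] x by (simp add: less_le)
  qed simp
  have "transpose_mat K = K"
    unfolding K_def transpose_kron[OF S(1) T(1)] sym_pos_defD(1)[OF S(2,1)] sym_pos_defD(1)[OF T(2,1)] ..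
  with sym_pos_def_congruence[OF one one_carrier_mat K Q QK]
  have "sym_pos_def (K * K)" using K by simp
  thus ?thesis unfolding K_def kron_mult[OF S(1) T(1) S(1) T(1)] S(3) T(3) .
qed

lemma mat_trace_four_block:
  assumes "A \<in> carrier_mat n n" and "D \<in> carrier_mat m m"
  shows "mat_trace (four_block_mat A B C D) = mat_trace A + mat_trace D"
proof -
  have split: "(\<Sum>i<n + m. f i) = (\<Sum>i<n. f i) + (\<Sum>i<m. f (n + i))" for f :: "nat \<Rightarrow> real"
    by (induction m) simp_all
  have "mat_trace (four_block_mat A B C D) = (\<Sum>i<n + m. four_block_mat A B C D $$ (i, i))"
    using assms by (simp add: mat_trace_def)
  also have "\<dots> = (\<Sum>i<n. four_block_mat A B C D $$ (i, i)) + (\<Sum>i<m. four_block_mat A B C D $$ (n + i, n + i))"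
    by (rule split)
  also have "\<dots> = mat_trace A + mat_trace D" using assms by (simp add: mat_trace_def)
  finally show ?thesis .
qed

text \<open>Since the Gram matrix is block diagonal, only the diagonal blocks \<open>Mu * (q \<cdot>\<^sub>m Cu)\<close> and
  \<open>kron Mu Mz * kron Cu Cz = kron (Mu * Cu) (Mz * Cz)\<close> of the product enter the trace.\<close>

lemma weighted_trace_theta:
  assumes "sym_pos_def Mu" and Mu: "Mu \<in> carrier_mat m m" and Cu: "Cu \<in> carrier_mat m m"
    and "sym_pos_def Mz" and Mz: "Mz \<in> carrier_mat n n" and Cz: "Cz \<in> carrier_mat n n"
    and z: "z \<in> carrier_vec n"
  shows "weighted_trace (theta_gram Mu Mz) (theta_cov Cu Cz Mz z) =
    weighted_trace Mu Cu * (1 + z \<bullet> ((Mz * Cz * Mz) *\<^sub>v z) + weighted_trace Mz Cz)"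
proof -
  define q where "q = 1 + z \<bullet> ((Mz * Cz * Mz) *\<^sub>v z)"
  define B where "B = - kron Cu (mat_of_row z * Mz * Cz)"
  define C where "C = - kron Cu (Cz * Mz * mat_of_cols (dim_vec z) [z])"
  have qCu: "q \<cdot>\<^sub>m Cu \<in> carrier_mat m m" using Cu by simp
  have "mat_of_row z * Mz * Cz \<in> carrier_mat 1 n" using Cz by (auto simp: mat_of_row_def)
  from kron_carrier[OF Cu this] have B: "B \<in> carrier_mat m (m * n)" by (simp add: B_def)
  have "Cz * Mz * mat_of_cols (dim_vec z) [z] \<in> carrier_mat n 1" using Cz by auto
  from kron_carrier[OF Cu this] have C: "C \<in> carrier_mat (m * n) m" by (simp add: C_def)
  note KM = kron_carrier[OF Mu Mz] and KC = kron_carrier[OF Cu Cz]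
  have G: "theta_gram Mu Mz = four_block_mat Mu (0\<^sub>m m (m * n)) (0\<^sub>m (m * n) m) (kron Mu Mz)"
    using Mu Mz by (simp add: theta_gram_def)
  have W: "theta_cov Cu Cz Mz z = four_block_mat (q \<cdot>\<^sub>m Cu) B C (kron Cu Cz)"
    by (simp add: theta_cov_def q_def B_def C_def)
  have "weighted_trace (theta_gram Mu Mz) (theta_cov Cu Cz Mz z) =
      mat_trace (theta_gram Mu Mz * theta_cov Cu Cz Mz z)"
  proof (rule weighted_trace_eq[of _ "m + m * n"])
    show "sym_pos_def (theta_gram Mu Mz)"
      unfolding G by (rule sym_pos_def_four_block[OF assms(1) Mu sym_pos_def_kron[OF assms(1) Mu assms(4) Mz] KM])
  qed (use Mu KM Cu KC in \<open>auto simp: G W\<close>)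
  also have "theta_gram Mu Mz * theta_cov Cu Cz Mz z =
      four_block_mat (Mu * (q \<cdot>\<^sub>m Cu) + 0\<^sub>m m (m * n) * C) (Mu * B + 0\<^sub>m m (m * n) * kron Cu Cz)
       (0\<^sub>m (m * n) m * (q \<cdot>\<^sub>m Cu) + kron Mu Mz * C) (0\<^sub>m (m * n) m * B + kron Mu Mz * kron Cu Cz)"
    unfolding G W by (rule mult_four_block_mat[OF Mu _ _ KM qCu B C KC]) auto
  also have "mat_trace \<dots> = mat_trace (Mu * (q \<cdot>\<^sub>m Cu) + 0\<^sub>m m (m * n) * C)
      + mat_trace (0\<^sub>m (m * n) m * B + kron Mu Mz * kron Cu Cz)"
    by (rule mat_trace_four_block[of _ m _ "m * n"]) (use Mu qCu C B KM KC in auto)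
  also have "Mu * (q \<cdot>\<^sub>m Cu) + 0\<^sub>m m (m * n) * C = q \<cdot>\<^sub>m (Mu * Cu)"
    using Mu Cu C mult_smult_distrib[OF Mu Cu] by simp
  also have "0\<^sub>m (m * n) m * B + kron Mu Mz * kron Cu Cz = kron (Mu * Cu) (Mz * Cz)"
    using B kron_mult[OF Mu Mz Cu Cz] kron_carrier[of "Mu * Cu" m m "Mz * Cz" n n] Mu Cu Mz Cz by simp
  also have "mat_trace \<dots> = mat_trace (Mu * Cu) * mat_trace (Mz * Cz)"
    by (rule mat_trace_kron) (use Mu Cu Mz Cz in auto)
  also have "mat_trace (q \<cdot>\<^sub>m (Mu * Cu)) = q * mat_trace (Mu * Cu)"
    using Mu Cu by (simp add: mat_trace_def sum_distrib_left)
  finally show ?thesis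
    by (simp add: weighted_trace_eq[OF assms(1) Mu Cu] weighted_trace_eq[OF assms(4) Mz Cz] q_def algebra_simps)
qed

section \<open>Coordinates and orthogonal projections\<close>

lemma gram_carrier [simp]: "gram bs \<in> carrier_mat (length bs) (length bs)"
  by (simp add: gram_def)

lemma inner_from_coords_nth:
  assumes "x \<in> carrier_vec (length bs)" and "i < length bs"
  shows "inner (bs ! i) (from_coords bs x) = (gram bs *\<^sub>v x) $ i"
  using assms by (simp add: from_coords_def gram_def inner_sum_right scalar_prod_def lessThan_atLeast0 mult.commute)

lemma inner_from_coords:
  assumes "x \<in> carrier_vec (length bs)" and "y \<in> carrier_vec (length bs)"
  shows "inner (from_coords bs x) (from_coords bs y) = x \<bullet> (gram bs *\<^sub>v y)"
proof -
  have "inner (from_coords bs x) (from_coords bs y) = (\<Sum>i<length bs. x $ i * inner (bs ! i) (from_coords bs y))"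
    by (simp add: from_coords_def[of bs x] inner_sum_left)
  also have "\<dots> = (\<Sum>i<length bs. x $ i * (gram bs *\<^sub>v y) $ i)"
    by (intro sum.cong refl) (simp only: lessThan_iff inner_from_coords_nth[OF assms(2)])
  also have "\<dots> = x \<bullet> (gram bs *\<^sub>v y)"
    using carrier_matD(1)[OF gram_carrier[of bs]] by (simp add: scalar_prod_def lessThan_atLeast0 del: index_mult_mat_vec)
  finally show ?thesis .
qed

lemma from_coords_minus:
  assumes "x \<in> carrier_vec (length bs)" and "y \<in> carrier_vec (length bs)"
  shows "from_coords bs (x - y) = from_coords bs x - from_coords bs y"
  using assms by (simp add: from_coords_def sum_subtractf[symmetric] algebra_simps)

lemma from_coords_in_span: "from_coords bs x \<in> span (set bs)"
  unfolding from_coords_def by (intro span_sum span_scale span_base) simp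

lemma coords_carrier [simp]: "coords bs v \<in> carrier_vec (length bs)"
  by (simp add: coords_def)

lemma coords_from_coords:
  assumes "distinct bs" and ind: "independent (set bs)" and x: "x \<in> carrier_vec (length bs)"
  shows "coords bs (from_coords bs x) = x"
proof (rule eq_vecI)
  fix i assume "i < dim_vec x"
  hence i: "i < length bs" using x by simp
  have "representation (set bs) (from_coords bs x) (bs ! i)
      = (\<Sum>k<length bs. representation (set bs) (x $ k *\<^sub>R bs ! k) (bs ! i))"
    unfolding from_coords_def using representation_sum[OF ind, of "{..<length bs}" "\<lambda>k. x $ k *\<^sub>R bs ! k"]
    by (simp add: span_scale span_base)
  also have "\<dots> = (\<Sum>k<length bs. if k = i then x $ i else 0)"
    using i assms(1)
    by (intro sum.cong refl)
      (auto simp: representation_scale[OF ind] representation_basis[OF ind] span_base nth_eq_iff_index_eq)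
  also have "\<dots> = x $ i" using i by simp
  finally show "coords bs (from_coords bs x) $ i = x $ i" using i by (simp add: coords_def)
qed (use x in \<open>simp add: coords_def\<close>)

lemma from_coords_coords:
  assumes "distinct bs" and "independent (set bs)" and "v \<in> span (set bs)"
  shows "from_coords bs (coords bs v) = v"
proof -
  have "from_coords bs (coords bs v) = (\<Sum>b\<in>set bs. representation (set bs) v b *\<^sub>R b)"
    unfolding from_coords_def coords_def
    using sum.reindex_bij_betw[OF bij_betw_nth[OF assms(1) refl refl], of "\<lambda>b. representation (set bs) v b *\<^sub>R b"]
    by simp
  also have "\<dots> = v" using sum_representation_eq[OF assms(2,3)] by simp
  finally show ?thesis .
qed

lemma sym_pos_def_gram:
  assumes "distinct bs" and "independent (set bs)"
  shows "sym_pos_def (gram bs)"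
proof (rule sym_pos_defI[OF gram_carrier])
  show "transpose_mat (gram bs) = gram bs"
    by (rule eq_matI) (auto simp: gram_def inner_commute)
  fix x :: "real vec" assume x: "x \<in> carrier_vec (length bs)" "x \<noteq> 0\<^sub>v (length bs)"
  have "from_coords bs x \<noteq> from_coords bs (0\<^sub>v (length bs))"
    using coords_from_coords[OF assms, of x] coords_from_coords[OF assms, of "0\<^sub>v (length bs)"] x by force
  hence "from_coords bs x \<noteq> 0" by (simp add: from_coords_def)
  thus "x \<bullet> (gram bs *\<^sub>v x) > 0" unfolding inner_from_coords[OF x(1) x(1), symmetric] by simp
qed

text \<open>Existence comes from solving the normal equations with the inverse Gram matrix; two
  candidates differ by a vector of the subspace that is orthogonal to itself.\<close>

lemma orth_proj:
  assumes dist: "distinct bs" and ind: "independent (set bs)"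
  shows "orth_proj (span (set bs)) x \<in> span (set bs)"
    and "w \<in> span (set bs) \<Longrightarrow> inner (x - orth_proj (span (set bs)) x) w = 0"
proof -
  let ?V = "span (set bs)" and ?n = "length bs"
  note G = sym_pos_def_inverse[OF sym_pos_def_gram[OF assms] gram_carrier]
  \<comment> \<open>The orthogonal projection of \<open>x\<close> has coordinates \<open>G\<^sup>-\<^sup>1 b\<close>, with load vector \<open>b\<close>.\<close>
  define b where "b = vec ?n (\<lambda>i. inner (bs ! i) x)"
  have b: "b \<in> carrier_vec ?n" by (simp add: b_def)
  define y where "y = from_coords bs (mat_inv (gram bs) *\<^sub>v b)"
  have c: "mat_inv (gram bs) *\<^sub>v b \<in> carrier_vec ?n" using G(1) b by simp
  have y: "y \<in> ?V" unfolding y_def by (rule from_coords_in_span)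
  have "gram bs *\<^sub>v (mat_inv (gram bs) *\<^sub>v b) = b"
    using assoc_mult_mat_vec[OF gram_carrier G(1) b] G(2) b by simp
  hence orth_nth: "inner (x - y) (bs ! i) = 0" if "i < ?n" for i
    using inner_from_coords_nth[OF c that] that by (simp add: y_def b_def inner_diff_left inner_diff_right inner_commute)
  have orth: "\<forall>w\<in>?V. inner (x - y) w = 0"
  proof
    fix w assume "w \<in> ?V"
    hence "inner (x - y) w = inner (x - y) (from_coords bs (coords bs w))"
      by (simp add: from_coords_coords[OF assms])
    also have "\<dots> = 0"
      unfolding from_coords_def inner_sum_right by (rule sum.neutral) (simp add: orth_nth)
    finally show "inner (x - y) w = 0" .
  qed
  have "orth_proj ?V x \<in> ?V \<and> (\<forall>w\<in>?V. inner (x - orth_proj ?V x) w = 0)"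
    unfolding orth_proj_def
  proof (rule theI[of _ y])
    fix y' assume y': "y' \<in> ?V \<and> (\<forall>w\<in>?V. inner (x - y') w = 0)"
    hence d: "y' - y \<in> ?V" using y by (simp add: span_diff)
    have "inner (y' - y) (y' - y) = inner (x - y) (y' - y) - inner (x - y') (y' - y)"
      by (simp add: inner_diff_left)
    also have "\<dots> = 0" using orth y' d by simp
    finally show "y' = y" by simp
  qed (use y orth in simp)
  thus "orth_proj ?V x \<in> ?V" and "w \<in> ?V \<Longrightarrow> inner (x - orth_proj ?V x) w = 0" by auto
qed

section \<open>The discrete solution operator and its Hilbert-Schmidt bound\<close>

lemma mat_trace_symmetric_square:
  assumes "B \<in> carrier_mat n n" and "transpose_mat B = B"
  shows "mat_trace (B * B) = (\<Sum>i<n. \<Sum>k<n. (B $$ (i, k))\<^sup>2)"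
proof -
  have "B $$ (k, i) = B $$ (i, k)" if "i < n" "k < n" for i k
    using that assms by (metis carrier_matD index_transpose_mat(1))
  thus ?thesis
    using assms(1) by (simp add: mat_trace_def scalar_prod_def lessThan_atLeast0 power2_eq_square)
qed

text \<open>The operator norm is at most the Frobenius norm, by Cauchy-Schwarz on each row.\<close>

lemma sq_norm_mult_mat_vec_le:
  assumes "B \<in> carrier_mat n n" and "transpose_mat B = B" and "e \<in> carrier_vec n"
  shows "(B *\<^sub>v e) \<bullet> (B *\<^sub>v e) \<le> mat_trace (B * B) * (e \<bullet> e)"
proof -
  have "(B *\<^sub>v e) \<bullet> (B *\<^sub>v e) = (\<Sum>i<n. (\<Sum>k<n. B $$ (i, k) * e $ k)\<^sup>2)"
    using assms(1,3) by (simp add: scalar_prod_def lessThan_atLeast0 power2_eq_square)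
  also have "\<dots> \<le> (\<Sum>i<n. (\<Sum>k<n. (B $$ (i, k))\<^sup>2) * (\<Sum>k<n. (e $ k)\<^sup>2))"
    by (intro sum_mono Cauchy_Schwarz_ineq_sum)
  also have "\<dots> = mat_trace (B * B) * (e \<bullet> e)"
    using assms(3) unfolding mat_trace_symmetric_square[OF assms(1,2)]
    by (simp add: sum_distrib_right scalar_prod_def lessThan_atLeast0 power2_eq_square)
  finally show ?thesis .
qed

lemma prior_cov_carrier:
  assumes "sym_pos_def E" and "E \<in> carrier_mat n n" and "M \<in> carrier_mat n n"
  shows "prior_cov \<alpha> E M \<in> carrier_mat n n"
  using sym_pos_def_inverse(1)[OF assms(1,2)] assms(3) by (simp add: prior_cov_def)

text \<open>Half of the symmetric factors can be moved across the scalar product; the form then becomes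
  \<open>\<alpha>\<close> times the squared \<open>M\<close> norm of the discrete solution \<open>(mat_inv E * M) *\<^sub>v z\<close>.\<close>

lemma prior_cov_quadratic_form:
  assumes "sym_pos_def E" and E: "E \<in> carrier_mat n n" and "sym_pos_def M" and M: "M \<in> carrier_mat n n"
    and z: "z \<in> carrier_vec n"
  shows "z \<bullet> ((M * prior_cov \<alpha> E M * M) *\<^sub>v z) =
    \<alpha> * (((mat_inv E * M) *\<^sub>v z) \<bullet> (M *\<^sub>v ((mat_inv E * M) *\<^sub>v z)))"
proof -
  note I = sym_pos_def_inverse[OF assms(1,2)]
  let ?I = "mat_inv E"
  define y where "y = ?I *\<^sub>v (M *\<^sub>v z)"
  have y: "y \<in> carrier_vec n" using I M z by (simp add: y_def)
  have IM: "(?I * M) *\<^sub>v z = y" using assoc_mult_mat_vec[OF I(1) M z] by (simp add: y_def)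
  have c: "M *\<^sub>v z \<in> carrier_vec n" "M *\<^sub>v y \<in> carrier_vec n" "?I *\<^sub>v (M *\<^sub>v y) \<in> carrier_vec n"
    using M z y I by auto
  note assoc = assoc_mult_mat_vec[of _ n n _ n]
  have "(M * prior_cov \<alpha> E M * M) *\<^sub>v z = \<alpha> \<cdot>\<^sub>v (M *\<^sub>v (?I *\<^sub>v (M *\<^sub>v y)))"
  proof -
    have "(M * prior_cov \<alpha> E M * M) = \<alpha> \<cdot>\<^sub>m (M * (?I * M * ?I) * M)"
      unfolding prior_cov_def using M I(1)
      by (simp add: mult_smult_distrib[of _ n n _ n] mult_smult_assoc_mat[of _ n n _ n])
    also have "\<dots> *\<^sub>v z = \<alpha> \<cdot>\<^sub>v ((M * (?I * M * ?I) * M) *\<^sub>v z)"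
      by (rule eq_vecI) (use M I(1) z in auto)
    also have "(M * (?I * M * ?I) * M) *\<^sub>v z = M *\<^sub>v (?I *\<^sub>v (M *\<^sub>v y))"
      unfolding y_def using M I(1) z by (simp add: assoc)
    finally show ?thesis .
  qed
  hence "z \<bullet> ((M * prior_cov \<alpha> E M * M) *\<^sub>v z) = \<alpha> * (z \<bullet> (M *\<^sub>v (?I *\<^sub>v (M *\<^sub>v y))))"
    using z M c by simp
  also have "z \<bullet> (M *\<^sub>v (?I *\<^sub>v (M *\<^sub>v y))) = (M *\<^sub>v z) \<bullet> (?I *\<^sub>v (M *\<^sub>v y))"
    using symmetric_scalar_prod[OF M sym_pos_defD(1)[OF assms(3) M] c(3) z] by simp
  also have "\<dots> = y \<bullet> (M *\<^sub>v y)"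
    using symmetric_scalar_prod[OF I(1,4) c(2) c(1)] by (simp add: y_def)
  finally show ?thesis by (simp add: IM)
qed

text \<open>In the coordinates \<open>mat_sqrt M *\<^sub>v z\<close>, which are orthonormal for the \<open>M\<close> inner product, the
  discrete solution operator becomes the symmetric matrix
  \<open>B = mat_sqrt M * mat_inv E * mat_sqrt M\<close>. The weighted trace is \<open>\<alpha>\<close> times the trace of
  \<open>B * B\<close>, that is, \<open>\<alpha>\<close> times the squared Frobenius norm of \<open>B\<close>.\<close>

lemma prior_cov_quadratic_form_le:
  assumes "sym_pos_def E" and E: "E \<in> carrier_mat n n" and "sym_pos_def M" and M: "M \<in> carrier_mat n n"
    and z: "z \<in> carrier_vec n" and \<alpha>: "\<alpha> \<ge> 0"
  shows "z \<bullet> ((M * prior_cov \<alpha> E M * M) *\<^sub>v z) \<le> weighted_trace M (prior_cov \<alpha> E M) * (z \<bullet> (M *\<^sub>v z))"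
    and "weighted_trace M (prior_cov \<alpha> E M) \<ge> 0"
proof -
  note I = sym_pos_def_inverse[OF assms(1,2)]
  note S = mat_sqrt[OF assms(3) M]
  note symS = sym_pos_defD(1)[OF S(2,1)]
  let ?I = "mat_inv E" and ?S = "mat_sqrt M"
  define B where "B = ?S * ?I * ?S"
  have B: "B \<in> carrier_mat n n" using S(1) I(1) by (simp add: B_def)
  note assoc = assoc_mult_mat[of _ n n _ n _ n]
  note assocv = assoc_mult_mat_vec[of _ n n _ n]
  have symB: "transpose_mat B = B"
    unfolding B_def using S(1) I(1) symS I(4) by (simp add: transpose_mult[of _ n n _ n] assoc)
  have norm: "x \<bullet> (M *\<^sub>v x) = (?S *\<^sub>v x) \<bullet> (?S *\<^sub>v x)" if "x \<in> carrier_vec n" for x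
    using symmetric_scalar_prod[OF S(1) symS, of "?S *\<^sub>v x" x] assoc_mult_mat_vec[OF S(1) S(1) that] S(1,3) that
    by simp
  define y where "y = (?I * M) *\<^sub>v z"
  have y: "y \<in> carrier_vec n" using I(1) M z by (simp add: y_def)
  have "?S *\<^sub>v y = (?S * (?I * (?S * ?S))) *\<^sub>v z"
    unfolding y_def S(3) using S(1) I(1) M z by (simp add: assocv)
  also have "\<dots> = B *\<^sub>v (?S *\<^sub>v z)"
    unfolding B_def using S(1) I(1) z by (simp add: assocv)
  finally have Sy: "?S *\<^sub>v y = B *\<^sub>v (?S *\<^sub>v z)" .
  have "?S * prior_cov \<alpha> E M * ?S = \<alpha> \<cdot>\<^sub>m (?S * (?I * (?S * ?S) * ?I) * ?S)"
    unfolding prior_cov_def S(3) using S(1) I(1) M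
    by (simp add: mult_smult_distrib[of _ n n _ n] mult_smult_assoc_mat[of _ n n _ n])
  also have "?S * (?I * (?S * ?S) * ?I) * ?S = B * B"
    unfolding B_def using S(1) I(1) by (simp add: assoc)
  finally have tr: "weighted_trace M (prior_cov \<alpha> E M) = \<alpha> * mat_trace (B * B)"
    using B by (simp add: weighted_trace_def mat_trace_def sum_distrib_left)
  have "z \<bullet> ((M * prior_cov \<alpha> E M * M) *\<^sub>v z) = \<alpha> * ((B *\<^sub>v (?S *\<^sub>v z)) \<bullet> (B *\<^sub>v (?S *\<^sub>v z)))"
    unfolding prior_cov_quadratic_form[OF assms(1-4) z] y_def[symmetric] norm[OF y] Sy ..
  also have "\<dots> \<le> \<alpha> * (mat_trace (B * B) * ((?S *\<^sub>v z) \<bullet> (?S *\<^sub>v z)))"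
    by (intro mult_left_mono \<alpha> sq_norm_mult_mat_vec_le[OF B symB]) (use S(1) z in simp)
  also have "\<dots> = weighted_trace M (prior_cov \<alpha> E M) * (z \<bullet> (M *\<^sub>v z))"
    by (simp add: tr norm[OF z])
  finally show "z \<bullet> ((M * prior_cov \<alpha> E M * M) *\<^sub>v z) \<le> weighted_trace M (prior_cov \<alpha> E M) * (z \<bullet> (M *\<^sub>v z))" .
  show "weighted_trace M (prior_cov \<alpha> E M) \<ge> 0"
    unfolding tr mat_trace_symmetric_square[OF B symB] by (intro mult_nonneg_nonneg \<alpha> sum_nonneg) simp_all
qed

text \<open>A stability estimate for discrete solutions: the difference of the two solutions is the
  solution for \<open>from_coords bs z\<close> minus the projection of \<open>x\<close>, and by Pythagoras replacing that
  projection by \<open>x\<close> itself only increases the distance.\<close>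

lemma coord_op_prior_error_le:
  assumes dist: "distinct bs" and ind: "independent (set bs)"
    and "sym_pos_def E" and E: "E \<in> carrier_mat (length bs) (length bs)" and \<alpha>: "\<alpha> \<ge> 0"
    and z: "z \<in> carrier_vec (length bs)"
  shows "\<alpha> * (norm (from_coords bs ((mat_inv E * gram bs) *\<^sub>v z) - coord_op bs (mat_inv E * gram bs) x))\<^sup>2
    \<le> weighted_trace (gram bs) (prior_cov \<alpha> E (gram bs)) * (norm (from_coords bs z - x))\<^sup>2"
proof -
  let ?n = "length bs" and ?M = "gram bs" and ?V = "span (set bs)"
  let ?A = "mat_inv E * ?M" and ?t = "weighted_trace ?M (prior_cov \<alpha> E ?M)"
  note I = sym_pos_def_inverse[OF assms(3,4)]
  note spdM = sym_pos_def_gram[OF dist ind]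
  have A: "?A \<in> carrier_mat ?n ?n" using I(1) gram_carrier by (rule mult_carrier_mat)
  define p where "p = orth_proj ?V x"
  define w where "w = coords bs p"
  note pV = orth_proj(1)[OF dist ind, of x, folded p_def] and orth = orth_proj(2)[OF dist ind, of _ x, folded p_def]
  have w: "w \<in> carrier_vec ?n" by (simp add: w_def)
  have wp: "from_coords bs w = p" unfolding w_def by (rule from_coords_coords[OF dist ind pV])
  define d where "d = z - w"
  have d: "d \<in> carrier_vec ?n" using z w by (simp add: d_def)
  have Ac: "?A *\<^sub>v v \<in> carrier_vec ?n" if "v \<in> carrier_vec ?n" for v using A that by (rule mult_mat_vec_carrier)
  have "from_coords bs (?A *\<^sub>v z) - coord_op bs ?A x = from_coords bs (?A *\<^sub>v d)"
    unfolding coord_op_def p_def[symmetric] w_def[symmetric] d_def mult_minus_distrib_mat_vec[OF A z w]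
    by (rule from_coords_minus[OF Ac[OF z] Ac[OF w], symmetric])
  hence "\<alpha> * (norm (from_coords bs (?A *\<^sub>v z) - coord_op bs ?A x))\<^sup>2
      = d \<bullet> ((?M * prior_cov \<alpha> E ?M * ?M) *\<^sub>v d)"
    by (simp add: power2_norm_eq_inner inner_from_coords[OF Ac[OF d] Ac[OF d]]
        prior_cov_quadratic_form[OF assms(3,4) spdM gram_carrier d])
  also have "\<dots> \<le> ?t * (d \<bullet> (?M *\<^sub>v d))"
    by (rule prior_cov_quadratic_form_le(1)[OF assms(3,4) spdM gram_carrier d \<alpha>])
  also have "d \<bullet> (?M *\<^sub>v d) = (norm (from_coords bs z - p))\<^sup>2"
    by (simp add: inner_from_coords[OF d d, symmetric] power2_norm_eq_inner from_coords_minus[OF z w, folded d_def] wp)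
  also have "?t * (norm (from_coords bs z - p))\<^sup>2 \<le> ?t * (norm (from_coords bs z - x))\<^sup>2"
  proof (rule mult_left_mono)
    have "inner (from_coords bs z - p) (p - x) = 0"
      using orth[OF span_diff[OF from_coords_in_span pV], of z] by (simp add: inner_diff_left inner_diff_right inner_commute)
    hence "(norm (from_coords bs z - x))\<^sup>2 = (norm (from_coords bs z - p))\<^sup>2 + (norm (p - x))\<^sup>2"
      using norm_add_Pythagorean[of "from_coords bs z - p" "p - x"] by (simp add: orthogonal_def)
    thus "(norm (from_coords bs z - p))\<^sup>2 \<le> (norm (from_coords bs z - x))\<^sup>2" by simp
    show "?t \<ge> 0" by (rule prior_cov_quadratic_form_le(2)[OF assms(3,4) spdM gram_carrier d \<alpha>])
  qed
  finally show ?thesis .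
qed

section \<open>Convergence of the trace\<close>

theorem theorem2:
  fixes Uh :: "'i \<Rightarrow> 'u::{real_inner, complete_space} set"
    and Zh :: "'j \<Rightarrow> 'z::{real_inner, complete_space} set"
    and Fu :: "'i filter" and Fz :: "'j filter" and H :: "('i \<times> 'j) filter"
    and \<eta> :: "'i \<Rightarrow> 'u list" and \<phi> :: "'j \<Rightarrow> 'z list"
    and Eu :: "'i \<Rightarrow> real mat" and Ez :: "'j \<Rightarrow> real mat"
    and \<alpha>u \<alpha>z :: real
    and J :: "'i \<Rightarrow> 'j \<Rightarrow> real Matrix.vec \<Rightarrow> real Matrix.vec \<Rightarrow> real"
    and S :: "'i \<Rightarrow> 'j \<Rightarrow> real Matrix.vec \<Rightarrow> real Matrix.vec"
    and ztilde :: "'i \<Rightarrow> 'j \<Rightarrow> real Matrix.vec"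
    and D\<E> :: "'z set" and \<E> :: "'z \<Rightarrow> 'z" and zlim :: 'z
  assumes "refining_family Fu Uh" and "refining_family Fz Zh"
    and "(\<exists>B. finite B \<and> span B = (UNIV :: 'z set)) \<longrightarrow> (\<forall>j. Zh j = UNIV)"
    and "H \<noteq> bot" and "H \<le> Fu \<times>\<^sub>F Fz"
    and "\<And>i. is_basis (\<eta> i) (Uh i)" and "\<And>j. is_basis (\<phi> j) (Zh j)"
    and "\<And>i j. S i j \<in> carrier_vec (length (\<phi> j)) \<rightarrow> carrier_vec (length (\<eta> i))"
    and "\<And>i j. local_minimizer (length (\<phi> j)) (\<lambda>z. J i j (S i j z) z) (ztilde i j)"
    and "\<alpha>u > 0" and "\<alpha>z > 0"
    and "\<And>i. Eu i \<in> carrier_mat (length (\<eta> i)) (length (\<eta> i)) \<and> sym_pos_def (Eu i)"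
    and "\<And>j. Ez j \<in> carrier_mat (length (\<phi> j)) (length (\<phi> j)) \<and> sym_pos_def (Ez j)"
    and "\<exists>L. strong_limit Fu
           (\<lambda>i. coord_op (\<eta> i) (prior_cov \<alpha>u (Eu i) (gram (\<eta> i)) * gram (\<eta> i))) L"
    and "self_adjoint_operator D\<E> \<E>" and "discretizes Fz \<phi> Ez D\<E> \<E>"
    and "strong_limit Fz
           (\<lambda>j. coord_op (\<phi> j) (prior_cov \<alpha>z (Ez j) (gram (\<phi> j)) * gram (\<phi> j)))
           (\<lambda>v. \<alpha>z *\<^sub>R inv_into D\<E> \<E> (inv_into D\<E> \<E> v))"
    and "\<exists>t. ((\<lambda>i. weighted_trace (gram (\<eta> i)) (prior_cov \<alpha>u (Eu i) (gram (\<eta> i)))) \<longlongrightarrow> t) Fu"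
    and "\<exists>t. ((\<lambda>j. weighted_trace (gram (\<phi> j)) (prior_cov \<alpha>z (Ez j) (gram (\<phi> j)))) \<longlongrightarrow> t) Fz"
    and "((\<lambda>(i, j). from_coords (\<phi> j) (ztilde i j)) \<longlongrightarrow> zlim) H"
  shows "\<exists>t. ((\<lambda>(i, j).
           weighted_trace
             (theta_gram (gram (\<eta> i)) (gram (\<phi> j)))
             (theta_cov
               (prior_cov \<alpha>u (Eu i) (gram (\<eta> i)))
               (prior_cov \<alpha>z (Ez j) (gram (\<phi> j)))
               (gram (\<phi> j)) (ztilde i j))) \<longlongrightarrow> t) H"
proof -
  have basis_\<eta>: "distinct (\<eta> i)" "independent (set (\<eta> i))" for i
    using assms(6)[of i] by (auto simp: is_basis_def)
  have basis_\<phi>: "distinct (\<phi> j)" "independent (set (\<phi> j))" for j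
    using assms(7)[of j] by (auto simp: is_basis_def)
  have Eu: "Eu i \<in> carrier_mat (length (\<eta> i)) (length (\<eta> i))" "sym_pos_def (Eu i)" for i
    using assms(12) by auto
  have Ez: "Ez j \<in> carrier_mat (length (\<phi> j)) (length (\<phi> j))" "sym_pos_def (Ez j)" for j
    using assms(13) by auto
  have z: "ztilde i j \<in> carrier_vec (length (\<phi> j))" for i j
    using assms(9)[of j i] by (simp add: local_minimizer_def)
  let ?tu = "\<lambda>i. weighted_trace (gram (\<eta> i)) (prior_cov \<alpha>u (Eu i) (gram (\<eta> i)))"
  let ?tz = "\<lambda>j. weighted_trace (gram (\<phi> j)) (prior_cov \<alpha>z (Ez j) (gram (\<phi> j)))"
  let ?A = "\<lambda>j. mat_inv (Ez j) * gram (\<phi> j)"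
  let ?y = "\<lambda>i j. from_coords (\<phi> j) (?A j *\<^sub>v ztilde i j)"
  obtain tu tz where tu: "(?tu \<longlongrightarrow> tu) Fu" and tz: "(?tz \<longlongrightarrow> tz) Fz"
    using assms(18,19) by blast
  have fst: "filterlim fst Fu H" and snd: "filterlim snd Fz H"
    using filterlim_mono[OF filterlim_fst order_refl assms(5)] filterlim_mono[OF filterlim_snd order_refl assms(5)] .
  define L where "L = inv_into D\<E> \<E> zlim"
  have R: "((\<lambda>j. coord_op (\<phi> j) (?A j) zlim) \<longlongrightarrow> L) Fz"
    using assms(16) by (simp add: discretizes_def strong_limit_def L_def)
  \<comment> \<open>Compares the solution for the moving argument with that for the fixed limit \<open>zlim\<close>; the trace
    controls the Lipschitz constant.\<close>
  have err: "norm (?y i j - coord_op (\<phi> j) (?A j) zlim)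
      \<le> sqrt (?tz j / \<alpha>z) * norm (from_coords (\<phi> j) (ztilde i j) - zlim)" for i j
  proof -
    have "(norm (?y i j - coord_op (\<phi> j) (?A j) zlim))\<^sup>2
        \<le> ?tz j / \<alpha>z * (norm (from_coords (\<phi> j) (ztilde i j) - zlim))\<^sup>2"
      using coord_op_prior_error_le[OF basis_\<phi> Ez(2,1) _ z, of \<alpha>z j i zlim] assms(11)
      by (simp add: field_simps)
    from real_sqrt_le_mono[OF this] show ?thesis unfolding real_sqrt_mult by simp
  qed
  have "((\<lambda>p. sqrt (?tz (snd p) / \<alpha>z) * norm (from_coords (\<phi> (snd p)) (ztilde (fst p) (snd p)) - zlim))
      \<longlongrightarrow> sqrt (tz / \<alpha>z) * norm (zlim - zlim)) H"
    using assms(11) assms(20)[unfolded case_prod_unfold]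
    by (intro tendsto_mult tendsto_real_sqrt tendsto_divide tendsto_norm tendsto_diff tendsto_const
        filterlim_compose[OF tz snd]) auto
  hence bound: "((\<lambda>p. sqrt (?tz (snd p) / \<alpha>z) * norm (from_coords (\<phi> (snd p)) (ztilde (fst p) (snd p)) - zlim))
      \<longlongrightarrow> 0) H"
    by simp
  have "((\<lambda>p. norm (?y (fst p) (snd p) - coord_op (\<phi> (snd p)) (?A (snd p)) zlim)) \<longlongrightarrow> 0) H"
    by (rule tendsto_sandwich[OF always_eventually always_eventually tendsto_const bound])
      (blast intro: norm_ge_zero err)+
  hence "((\<lambda>p. ?y (fst p) (snd p) - coord_op (\<phi> (snd p)) (?A (snd p)) zlim) \<longlongrightarrow> 0) H"
    by (rule tendsto_norm_zero_cancel)
  from tendsto_add[OF this filterlim_compose[OF R snd]]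
  have y: "((\<lambda>p. ?y (fst p) (snd p)) \<longlongrightarrow> L) H" by simp
  have "((\<lambda>p. ?tu (fst p) * (1 + \<alpha>z * (norm (?y (fst p) (snd p)))\<^sup>2 + ?tz (snd p)))
      \<longlongrightarrow> tu * (1 + \<alpha>z * (norm L)\<^sup>2 + tz)) H"
    by (intro tendsto_mult tendsto_add tendsto_power tendsto_norm tendsto_const y
        filterlim_compose[OF tu fst] filterlim_compose[OF tz snd])
  moreover have "weighted_trace (theta_gram (gram (\<eta> i)) (gram (\<phi> j)))
      (theta_cov (prior_cov \<alpha>u (Eu i) (gram (\<eta> i))) (prior_cov \<alpha>z (Ez j) (gram (\<phi> j))) (gram (\<phi> j)) (ztilde i j))
      = ?tu i * (1 + \<alpha>z * (norm (?y i j))\<^sup>2 + ?tz j)" for i j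
  proof -
    have "?A j *\<^sub>v ztilde i j \<in> carrier_vec (length (\<phi> j))"
      using sym_pos_def_inverse(1)[OF Ez(2,1)] z by (intro mult_mat_vec_carrier mult_carrier_mat) auto
    hence "(norm (?y i j))\<^sup>2 = (?A j *\<^sub>v ztilde i j) \<bullet> (gram (\<phi> j) *\<^sub>v (?A j *\<^sub>v ztilde i j))"
      by (simp only: power2_norm_eq_inner inner_from_coords)
    thus ?thesis
      using weighted_trace_theta[OF sym_pos_def_gram[OF basis_\<eta>] gram_carrier
          prior_cov_carrier[OF Eu(2,1) gram_carrier] sym_pos_def_gram[OF basis_\<phi>] gram_carrier
          prior_cov_carrier[OF Ez(2,1) gram_carrier] z]
        prior_cov_quadratic_form[OF Ez(2,1) sym_pos_def_gram[OF basis_\<phi>] gram_carrier z]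
      by simp
  qed
  ultimately show ?thesis by (auto simp: case_prod_unfold)
qed

end
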